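(* Let $\alpha=(\alpha_n)_{n\in\mathbb N}$ be a sequence of positive real numbers with $$\sum_{n\in\mathbb N}\frac1{\alpha_n}<\infty.$$ Then the norm of the Schrödinger operator $e^{it\Delta_\alpha}$ from $L^1(\mathcal R)$ to $L^\infty(\mathcal R)$ does not tend to zero as $|t|$ goes to infinity.
   Context: Here $\mathbb N=\{0,1,2,\dots\}$ and $\mathcal R=\bigcup_{n\in\mathbb N}e_n$ is the infinite network with edges $e_n=(n,n+1)$ and vertices $v_n=\{n\}$. Functions on $\mathcal R$ are sequences $u=(u_n)_{n}$ with $u_n$ defined on $e_n$. $L^2(\mathcal R,\alpha)$ is the Hilbert space of $u$ with $u_n\in L^2(e_n)$ and $\sum_n\alpha_n\int_{e_n}|u_n|^2dx<\infty$, with the corresponding weighted inner product; $H^2(\mathcal R,\alpha)$ is the space of $u\in L^2(\mathcal R,\alpha)$ with $(u_n')_n,(u_n'')_n\in L^2(\mathcal R,\alpha)$. $L^1(\mathcal R)$ and $L^\infty(\mathcal R)$ are unweighted: $\|u\|_{L^1(\mathcal R)}=\sum_n\int_{e_n}|u_n|dx$, $\|u\|_{L^\infty(\mathcal R)}=\sup_n\|u_n\|_{L^\infty(e_n)}$. $-\Delta_\alpha$ is the non-negative self-adjoint operator in $L^2(\mathcal R,\alpha)$ given by $-\Delta_\alpha u=(-u_n'')_n$, with domain the set of $u\in H^2(\mathcal R,\alpha)$ satisfying $u_0(0)=0$, $u_n(n+1)=u_{n+1}(n+1)$ and $\alpha_nu_n'(n+1)=\alpha_{n+1}u_{n+1}'(n+1)$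 for all $n\in\mathbb N$. The norm of $e^{it\Delta_\alpha}$ from $L^1(\mathcal R)$ to $L^\infty(\mathcal R)$ is the supremum (in $[0,+\infty]$) of $\|e^{it\Delta_\alpha}u\|_{L^\infty(\mathcal R)}/\|u\|_{L^1(\mathcal R)}$ over nonzero $u\in L^1(\mathcal R)\cap L^2(\mathcal R,\alpha)$. *)

theory Defs
  imports "HOL-Analysis.Analysis" "HOL-Probability.Essential_Supremum"
begin

text \<open>
  A function on the network is a sequence \<open>u\<close>, where only the values of \<open>u n\<close> on the open edge
  \<open>e\<^sub>n = (n, n + 1)\<close> matter. Elements of the Lebesgue spaces are represented by functions, and
  equality of the classes is \<open>net_eq\<close>.
\<close>

type_synonym netfun = "nat \<Rightarrow> real \<Rightarrow> complex"

definition edge :: "nat \<Rightarrow> real set" where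
  "edge n = {real n<..<real n + 1}"

abbreviation edge_measure :: "nat \<Rightarrow> real measure" where
  "edge_measure n \<equiv> lebesgue_on (edge n)"

definition net_measurable :: "netfun \<Rightarrow> bool" where
  "net_measurable u \<longleftrightarrow> (\<forall>n. u n \<in> borel_measurable (edge_measure n))"

definition net_eq :: "netfun \<Rightarrow> netfun \<Rightarrow> bool" where
  "net_eq u v \<longleftrightarrow> (\<forall>n. AE x in edge_measure n. u n x = v n x)"

subsection \<open>Lebesgue spaces\<close>

definition L2_net :: "(nat \<Rightarrow> real) \<Rightarrow> netfun set" where
  "L2_net \<alpha> = {u. net_measurable u \<and>
     (\<forall>n. integrable (edge_measure n) (\<lambda>x. (cmod (u n x))\<^sup>2)) \<and>
     summable (\<lambda>n. \<alpha> n * (\<integral>x. (cmod (u n x))\<^sup>2 \<partial>edge_measure n))}"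

definition L2_inner :: "(nat \<Rightarrow> real) \<Rightarrow> netfun \<Rightarrow> netfun \<Rightarrow> complex" where
  "L2_inner \<alpha> u v =
     (\<Sum>n. complex_of_real (\<alpha> n) * (\<integral>x. u n x * cnj (v n x) \<partial>edge_measure n))"

definition L2_norm :: "(nat \<Rightarrow> real) \<Rightarrow> netfun \<Rightarrow> real" where
  "L2_norm \<alpha> u = sqrt (\<Sum>n. \<alpha> n * (\<integral>x. (cmod (u n x))\<^sup>2 \<partial>edge_measure n))"

definition L1_norm :: "netfun \<Rightarrow> ennreal" where
  "L1_norm u = (\<Sum>n. \<integral>\<^sup>+x. ennreal (cmod (u n x)) \<partial>edge_measure n)"

definition L1_net :: "netfun set" where
  "L1_net = {u. net_measurable u \<and> L1_norm u < \<infinity>}"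

definition Linf_norm :: "netfun \<Rightarrow> ennreal" where
  "Linf_norm u = (SUP n. esssup (edge_measure n) (\<lambda>x. ennreal (cmod (u n x))))"

subsection \<open>Sobolev regularity and traces\<close>

definition test_function :: "nat \<Rightarrow> (real \<Rightarrow> real) \<Rightarrow> bool" where
  "test_function n \<phi> \<longleftrightarrow>
     (\<forall>k x. (deriv ^^ k) \<phi> field_differentiable (at x)) \<and>
     (\<exists>K. compact K \<and> K \<subseteq> edge n \<and> (\<forall>x. x \<notin> K \<longrightarrow> \<phi> x = 0))"

text \<open>
  Only used for functions that are square integrable on the edge, for which both integrals exist.
\<close>

definition weak_deriv :: "nat \<Rightarrow> (real \<Rightarrow> complex) \<Rightarrow> (real \<Rightarrow> complex) \<Rightarrow> bool" where
  "weak_deriv n f g \<longleftrightarrow>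
     (\<forall>\<phi>. test_function n \<phi> \<longrightarrow>
       (\<integral>x. f x * complex_of_real (deriv \<phi> x) \<partial>edge_measure n) =
       - (\<integral>x. g x * complex_of_real (\<phi> x) \<partial>edge_measure n))"

text \<open>
  The boundary value, at an endpoint \<open>x\<close> of the edge, of the representative of \<open>f\<close> that is
  continuous on the closed edge; it exists for every function in \<open>H\<^sup>1(e\<^sub>n)\<close> and is unique.
\<close>

definition edge_trace :: "nat \<Rightarrow> (real \<Rightarrow> complex) \<Rightarrow> real \<Rightarrow> complex" where
  "edge_trace n f x = (THE c. \<exists>g. continuous_on {real n..real n + 1} g \<and>
     (AE y in edge_measure n. g y = f y) \<and> g x = c)"

text \<open>\<open>u\<close> is in \<open>H\<^sup>2(R, \<alpha>)\<close> with first and second derivatives \<open>u1\<close> and \<open>u2\<close>.\<close>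

definition H2_net :: "(nat \<Rightarrow> real) \<Rightarrow> netfun \<Rightarrow> netfun \<Rightarrow> netfun \<Rightarrow> bool" where
  "H2_net \<alpha> u u1 u2 \<longleftrightarrow>
     u \<in> L2_net \<alpha> \<and> u1 \<in> L2_net \<alpha> \<and> u2 \<in> L2_net \<alpha> \<and>
     (\<forall>n. weak_deriv n (u n) (u1 n) \<and> weak_deriv n (u1 n) (u2 n))"

subsection \<open>The operator and its unitary group\<close>

text \<open>The graph of the operator: \<open>u\<close> is in its domain, and it maps \<open>u\<close> to \<open>w = (u\<^sub>n'')\<^sub>n\<close>.\<close>

definition laplacian :: "(nat \<Rightarrow> real) \<Rightarrow> netfun \<Rightarrow> netfun \<Rightarrow> bool" where
  "laplacian \<alpha> u w \<longleftrightarrow>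
     (\<exists>u1. H2_net \<alpha> u u1 w \<and>
       edge_trace 0 (u 0) 0 = 0 \<and>
       (\<forall>n. edge_trace n (u n) (real n + 1) = edge_trace (Suc n) (u (Suc n)) (real n + 1)) \<and>
       (\<forall>n. complex_of_real (\<alpha> n) * edge_trace n (u1 n) (real n + 1) =
            complex_of_real (\<alpha> (Suc n)) * edge_trace (Suc n) (u1 (Suc n)) (real n + 1)))"

text \<open>
  Strongly continuous one-parameter groups of unitary operators; surjectivity of \<open>U t\<close> follows
  from the group law, and compatibility with \<open>net_eq\<close> from linearity and preservation of the
  inner product.
\<close>

definition unitary_group :: "(nat \<Rightarrow> real) \<Rightarrow> (real \<Rightarrow> netfun \<Rightarrow> netfun) \<Rightarrow> bool" where
  "unitary_group \<alpha> U \<longleftrightarrow>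
     (\<forall>t. \<forall>u \<in> L2_net \<alpha>. U t u \<in> L2_net \<alpha>) \<and>
     (\<forall>t a b. \<forall>u \<in> L2_net \<alpha>. \<forall>v \<in> L2_net \<alpha>.
        net_eq (U t (\<lambda>n x. a * u n x + b * v n x)) (\<lambda>n x. a * U t u n x + b * U t v n x)) \<and>
     (\<forall>t. \<forall>u \<in> L2_net \<alpha>. \<forall>v \<in> L2_net \<alpha>. L2_inner \<alpha> (U t u) (U t v) = L2_inner \<alpha> u v) \<and>
     (\<forall>u \<in> L2_net \<alpha>. net_eq (U 0 u) u) \<and>
     (\<forall>s t. \<forall>u \<in> L2_net \<alpha>. net_eq (U (s + t) u) (U s (U t u))) \<and>
     (\<forall>u \<in> L2_net \<alpha>. ((\<lambda>t. L2_norm \<alpha> (\<lambda>n x. U t u n x - u n x)) \<longlongrightarrow> 0) (at 0))"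

text \<open>\<open>u\<close> is in the domain of the infinitesimal generator of \<open>U\<close>, which maps \<open>u\<close> to \<open>v\<close>.\<close>

definition generator ::
  "(nat \<Rightarrow> real) \<Rightarrow> (real \<Rightarrow> netfun \<Rightarrow> netfun) \<Rightarrow> netfun \<Rightarrow> netfun \<Rightarrow> bool" where
  "generator \<alpha> U u v \<longleftrightarrow> u \<in> L2_net \<alpha> \<and> v \<in> L2_net \<alpha> \<and>
     ((\<lambda>h. L2_norm \<alpha> (\<lambda>n x. (U h u n x - u n x) / complex_of_real h - v n x)) \<longlongrightarrow> 0) (at 0)"

text \<open>
  \<open>U t = e\<^sup>i\<^sup>t\<^sup>\<Delta>\<close> for all \<open>t\<close>, that is, \<open>U\<close> is the unitary group with generator \<open>i \<Delta>\<close>. As the operator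
  \<open>\<Delta>\<close> is self-adjoint, Stone's theorem gives existence and uniqueness (up to \<open>net_eq\<close>) of \<open>U\<close>.
\<close>

definition schroedinger_group :: "(nat \<Rightarrow> real) \<Rightarrow> (real \<Rightarrow> netfun \<Rightarrow> netfun) \<Rightarrow> bool" where
  "schroedinger_group \<alpha> U \<longleftrightarrow> unitary_group \<alpha> U \<and>
     (\<forall>u w. generator \<alpha> U u (\<lambda>n x. \<i> * w n x) \<longleftrightarrow> laplacian \<alpha> u w)"

definition L1_Linf_norm :: "(nat \<Rightarrow> real) \<Rightarrow> (netfun \<Rightarrow> netfun) \<Rightarrow> ennreal" where
  "L1_Linf_norm \<alpha> T =
     (SUP u \<in> {u \<in> L1_net \<inter> L2_net \<alpha>. \<not> net_eq u (\<lambda>n x. 0)}. Linf_norm (T u) / L1_norm u)"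

end

theory Submission
  imports Defs "HOL-Probability.Probability_Measure"
begin

text \<open>
  The function \<open>\<phi>\<^sub>n(x) = sin (\<pi> x) / \<alpha>\<^sub>n\<close> vanishes at all vertices, and \<open>\<alpha>\<^sub>n \<phi>\<^sub>n'\<close> does not depend
  on \<open>n\<close>. As \<open>1/\<alpha>\<close> is summable, \<open>\<phi>\<close> is in \<open>L\<^sup>1\<close> and is an eigenfunction of \<open>-\<Delta>\<^sub>\<alpha>\<close> in \<open>L\<^sup>2\<close> with
  eigenvalue \<open>\<pi>\<^sup>2\<close>. The mean \<open>g(t)\<close> of its orbit over \<open>e\<^sub>0\<close> solves
  \<open>g' = -i \<pi>\<^sup>2 g\<close> and so has constant modulus \<open>2 / (\<pi> \<alpha>\<^sub>0)\<close>, so the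
  sup norm of the orbit does not decay.
\<close>

subsection \<open>Integration on an edge\<close>

lemma edge_sets [measurable]: "edge n \<in> sets lebesgue"
  by (simp add: edge_def)

text \<open>Every edge has length one, so an integral over an edge is a mean, and the inequalities
  for probability spaces apply without extra constants.\<close>

lemma prob_space_edge: "prob_space (edge_measure n)"
proof
  have "emeasure (edge_measure n) (edge n) = emeasure lebesgue (edge n)"
    by (rule emeasure_restrict_space) (auto simp: edge_sets)
  also have "\<dots> = 1"
    by (simp add: edge_def)
  finally show "emeasure (edge_measure n) (space (edge_measure n)) = 1" by simp
qed

lemma measurable_edge:
  fixes f :: "real \<Rightarrow> 'a::euclidean_space"
  assumes "continuous_on UNIV f"
  shows "f \<in> borel_measurable (edge_measure n)"
  by (rule continuous_imp_measurable_on_sets_lebesgue)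
     (use assms continuous_on_subset edge_sets in auto)

text \<open>The edge lies in a compact interval, on which a continuous function is bounded, and its
  measure is finite.\<close>

lemma integrable_edge:
  fixes f :: "real \<Rightarrow> 'a::euclidean_space"
  assumes "continuous_on UNIV f"
  shows "integrable (edge_measure n) f"
proof -
  interpret prob_space "edge_measure n" by (rule prob_space_edge)
  have "compact (f ` {real n..real n + 1})"
    by (rule compact_continuous_image) (use assms continuous_on_subset in auto)
  then obtain B where B: "\<forall>y \<in> f ` {real n..real n + 1}. norm y \<le> B"
    using compact_imp_bounded bounded_iff by metis
  show ?thesis
    by (rule integrable_const_bound[where B=B])
       (use B in \<open>auto simp: edge_def intro!: AE_I2 measurable_edge[unfolded edge_def] assms\<close>)
qed

lemma integral_edge_FTC:
  fixes F :: "real \<Rightarrow> 'a::euclidean_space"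
  assumes "\<And>x. (F has_vector_derivative f x) (at x)" and "continuous_on UNIV f"
  shows "(\<integral>x. f x \<partial>edge_measure n) = F (real n + 1) - F (real n)"
proof -
  have "(f has_integral (F (real n + 1) - F (real n))) {real n..real n + 1}"
    by (rule fundamental_theorem_of_calculus) (auto intro: has_vector_derivative_at_within assms)
  then have "integral (edge n) f = F (real n + 1) - F (real n)"
    by (simp add: edge_def integral_unique flip: integral_open_interval_real)
  then show ?thesis
    by (simp add: lebesgue_integral_eq_integral integrable_edge assms edge_sets)
qed

section \<open>Classical derivatives as weak derivatives, and traces of continuous functions\<close>

text \<open>Integration by parts: the derivative of the product with a test function integrates to
  boundary terms. These vanish because the test function is supported inside the open edge, which
  omits both endpoints.\<close>

lemma weak_deriv_of_vector_derivative:
  assumes f: "\<And>x. (f has_vector_derivative g x) (at x)" and g: "continuous_on UNIV g"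
  shows "weak_deriv n f g"
  unfolding weak_deriv_def
proof (intro allI impI)
  fix \<phi> assume \<phi>: "test_function n \<phi>"
  have d: "(deriv ^^ k) \<phi> field_differentiable (at x)" for k x
    using \<phi> by (simp add: test_function_def)
  have d0: "(\<phi> has_field_derivative deriv \<phi> x) (at x)" for x
    using d[of 0 x] by (simp add: field_differentiable_derivI)
  have c0: "continuous_on UNIV \<phi>"
    using d[of 0] by (simp add: continuous_at_imp_continuous_on field_differentiable_imp_continuous_at)
  have c1: "continuous_on UNIV (deriv \<phi>)"
    using d[of 1] by (simp add: continuous_at_imp_continuous_on field_differentiable_imp_continuous_at)
  have cf: "continuous_on UNIV f"
    using f by (meson continuous_at_imp_continuous_on has_vector_derivative_continuous)
  have endpoints: "\<phi> (real n) = 0" "\<phi> (real n + 1) = 0"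
    using \<phi> by (auto simp: test_function_def edge_def)
  have i1: "integrable (edge_measure n) (\<lambda>x. f x * complex_of_real (deriv \<phi> x))"
    by (intro integrable_edge continuous_intros cf c1)
  have i2: "integrable (edge_measure n) (\<lambda>x. g x * complex_of_real (\<phi> x))"
    by (intro integrable_edge continuous_intros g c0)
  have "(\<integral>x. f x * complex_of_real (deriv \<phi> x) + g x * complex_of_real (\<phi> x) \<partial>edge_measure n) =
      f (real n + 1) * complex_of_real (\<phi> (real n + 1)) - f (real n) * complex_of_real (\<phi> (real n))"
    by (rule integral_edge_FTC)
       (intro has_vector_derivative_mult f has_vector_derivative_of_real
          has_real_derivative_iff_has_vector_derivative[THEN iffD1] d0 continuous_intros cf c1 c0 g)+
  then show "(\<integral>x. f x * complex_of_real (deriv \<phi> x) \<partial>edge_measure n) =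
      - (\<integral>x. g x * complex_of_real (\<phi> x) \<partial>edge_measure n)"
    using i1 i2 by (simp add: endpoints eq_neg_iff_add_eq_0)
qed

text \<open>The set where two continuous functions differ on the edge is open and null, hence empty.
  The endpoints follow because the edge is dense in the closed interval. This gives the uniqueness
  behind \<open>edge_trace\<close>.\<close>

lemma AE_edge_eq_imp_eq:
  fixes f g :: "real \<Rightarrow> complex"
  assumes f: "continuous_on {real n..real n + 1} f" and g: "continuous_on {real n..real n + 1} g"
    and eq: "AE y in edge_measure n. g y = f y" and x: "x \<in> {real n..real n + 1}"
  shows "g x = f x"
proof -
  let ?S = "{y \<in> edge n. g y - f y \<noteq> 0}"
  have "edge n \<subseteq> {real n..real n + 1}"
    by (auto simp: edge_def)
  then have "continuous_on (edge n) (\<lambda>y. g y - f y)"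
    using f g by (intro continuous_on_diff) (auto intro: continuous_on_subset)
  then have "open (edge n \<inter> (\<lambda>y. g y - f y) -` (- {0}))"
    by (rule continuous_open_preimage) (auto simp: edge_def)
  also have "edge n \<inter> (\<lambda>y. g y - f y) -` (- {0}) = ?S"
    by auto
  finally have "open ?S" .
  moreover have "negligible ?S"
  proof -
    have "AE y in lebesgue. y \<in> edge n \<longrightarrow> g y = f y"
      using eq by (subst (asm) AE_restrict_space_iff) (auto simp: edge_sets)
    then have "{y. \<not> (y \<in> edge n \<longrightarrow> g y = f y)} \<in> null_sets lebesgue"
      by (simp add: AE_iff_null_sets completion.AE_iff_null_sets)
    also have "{y. \<not> (y \<in> edge n \<longrightarrow> g y = f y)} = ?S" by auto
    finally show ?thesis by (simp add: negligible_iff_null_sets)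
  qed
  ultimately have "?S = {}"
    using open_not_negligible by blast
  then have "g y = f y" if "y \<in> edge n" for y
    using that by auto
  moreover have "closure (edge n) = {real n..real n + 1}"
    by (simp add: edge_def)
  ultimately have "g x - f x = 0"
    using continuous_on_diff[OF g f] x
    by (intro continuous_constant_on_closure[of "edge n" "\<lambda>y. g y - f y" 0 x]) auto
  then show ?thesis by simp
qed

lemma edge_trace_eq:
  assumes f: "continuous_on {real n..real n + 1} f" and x: "x \<in> {real n..real n + 1}"
  shows "edge_trace n f x = f x"
  unfolding edge_trace_def
proof (rule the_equality)
  show "\<exists>g. continuous_on {real n..real n + 1} g \<and> (AE y in edge_measure n. g y = f y) \<and> g x = f x"
    using f by auto
next
  fix c
  assume "\<exists>g. continuous_on {real n..real n + 1} g \<and> (AE y in edge_measure n. g y = f y) \<and> g x = c"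
  then show "c = f x"
    using AE_edge_eq_imp_eq[OF f _ _ x] by blast
qed

section \<open>Bounds for the mean over an edge\<close>

lemma square_integrable_edge:
  fixes f :: "real \<Rightarrow> complex"
  assumes f: "f \<in> borel_measurable (edge_measure n)"
    and f2: "integrable (edge_measure n) (\<lambda>x. (cmod (f x))\<^sup>2)"
  shows integrable_of_square_integrable_edge: "integrable (edge_measure n) f"
    and norm_integral_edge_le:
      "(cmod (\<integral>x. f x \<partial>edge_measure n))\<^sup>2 \<le> (\<integral>x. (cmod (f x))\<^sup>2 \<partial>edge_measure n)"
proof -
  interpret prob_space "edge_measure n" by (rule prob_space_edge)
  have n1: "integrable (edge_measure n) (\<lambda>x. cmod (f x))"
    by (rule square_integrable_imp_integrable) (use f f2 in auto)
  then show i: "integrable (edge_measure n) f"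
    using f integrable_norm_cancel by blast
  \<comment> \<open>The Cauchy-Schwarz inequality against the constant 1, obtained as non-negativity
    of the variance of the modulus.\<close>
  have "0 \<le> expectation (\<lambda>x. (cmod (f x))\<^sup>2) - (expectation (\<lambda>x. cmod (f x)))\<^sup>2"
    using variance_positive[of "\<lambda>x. cmod (f x)"] variance_eq[OF n1 f2] by simp
  moreover have "(cmod (expectation f))\<^sup>2 \<le> (expectation (\<lambda>x. cmod (f x)))\<^sup>2"
    by (intro power_mono) auto
  ultimately show "(cmod (expectation f))\<^sup>2 \<le> expectation (\<lambda>x. (cmod (f x))\<^sup>2)"
    by linarith
qed

text \<open>The modulus of a mean is at most the mean of the modulus, hence at most the essential
  supremum, as the total mass is 1. A lower bound on a mean thus becomes a lower bound on
  \<open>Linf_norm\<close>.\<close>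

lemma norm_integral_edge_le_esssup:
  fixes f :: "real \<Rightarrow> complex"
  assumes "integrable (edge_measure n) f"
  shows "ennreal (cmod (\<integral>x. f x \<partial>edge_measure n)) \<le> esssup (edge_measure n) (\<lambda>x. ennreal (cmod (f x)))"
proof -
  interpret prob_space "edge_measure n" by (rule prob_space_edge)
  have "ennreal (cmod (expectation f)) \<le> (\<integral>\<^sup>+x. ennreal (cmod (f x)) \<partial>edge_measure n)"
    by (rule integral_norm_bound_ennreal[OF assms])
  also have "\<dots> \<le> (\<integral>\<^sup>+x. esssup (edge_measure n) (\<lambda>x. ennreal (cmod (f x))) \<partial>edge_measure n)"
    by (intro nn_integral_mono_AE esssup_AE)
  also have "\<dots> = esssup (edge_measure n) (\<lambda>x. ennreal (cmod (f x)))"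
    by (simp only: nn_integral_const emeasure_space_1 mult_1_right)
  finally show ?thesis .
qed

subsection \<open>The space $L^2$ of the network\<close>

lemma L2_netD:
  assumes "u \<in> L2_net \<alpha>"
  shows "u n \<in> borel_measurable (edge_measure n)"
    and "integrable (edge_measure n) (\<lambda>x. (cmod (u n x))\<^sup>2)"
    and "summable (\<lambda>n. \<alpha> n * (\<integral>x. (cmod (u n x))\<^sup>2 \<partial>edge_measure n))"
    and "integrable (edge_measure n) (u n)"
  using assms integrable_of_square_integrable_edge[of "u n" n]
  by (auto simp: L2_net_def net_measurable_def)

lemma L2_net_combination:
  assumes \<alpha>: "\<And>n. \<alpha> n > 0" and u: "u \<in> L2_net \<alpha>" and v: "v \<in> L2_net \<alpha>"
  shows "(\<lambda>n x. a * u n x + b * v n x) \<in> L2_net \<alpha>"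
proof -
  let ?I = "\<lambda>u n. \<integral>x. (cmod (u n x))\<^sup>2 \<partial>edge_measure n"
  let ?w = "\<lambda>n x. a * u n x + b * v n x"
  let ?B = "\<lambda>n x. 2 * (cmod a)\<^sup>2 * (cmod (u n x))\<^sup>2 + 2 * (cmod b)\<^sup>2 * (cmod (v n x))\<^sup>2"
  note [measurable] = L2_netD(1)[OF u] L2_netD(1)[OF v]
  have m: "?w n \<in> borel_measurable (edge_measure n)" for n
    by measurable
  have le: "(cmod (?w n x))\<^sup>2 \<le> ?B n x" for n x
  proof -
    have "(cmod (?w n x))\<^sup>2 \<le> (cmod a * cmod (u n x) + cmod b * cmod (v n x))\<^sup>2"
      by (intro power_mono) (metis norm_mult norm_triangle_ineq, simp)
    \<comment> \<open>This is (p + q)^2 \<le> 2 p^2 + 2 q^2, which follows from 2 p q \<le> p^2 +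
      q^2.\<close>
    also have "\<dots> \<le> 2 * (cmod a * cmod (u n x))\<^sup>2 + 2 * (cmod b * cmod (v n x))\<^sup>2"
      using sum_squares_bound[of "cmod a * cmod (u n x)" "cmod b * cmod (v n x)"]
      by (simp add: power2_sum)
    finally show ?thesis by (simp add: power_mult_distrib)
  qed
  have iB: "integrable (edge_measure n) (?B n)" for n
    by (intro Bochner_Integration.integrable_add integrable_mult_right L2_netD(2)[OF u] L2_netD(2)[OF v])
  have i: "integrable (edge_measure n) (\<lambda>x. (cmod (?w n x))\<^sup>2)" for n
    by (rule Bochner_Integration.integrable_bound[OF iB _ AE_I2]) (use m le in auto)
  have I: "\<alpha> n * ?I ?w n \<le>
      2 * (cmod a)\<^sup>2 * (\<alpha> n * ?I u n) + 2 * (cmod b)\<^sup>2 * (\<alpha> n * ?I v n)" for n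
  proof -
    have "?I ?w n \<le> (\<integral>x. ?B n x \<partial>edge_measure n)"
      by (rule integral_mono[OF i iB le])
    also have "\<dots> = 2 * (cmod a)\<^sup>2 * ?I u n + 2 * (cmod b)\<^sup>2 * ?I v n"
      by (subst Bochner_Integration.integral_add)
         (auto intro: L2_netD(2)[OF u] L2_netD(2)[OF v])
    finally have "\<alpha> n * ?I ?w n \<le> \<alpha> n * \<dots>"
      using \<alpha>[of n] by (intro mult_left_mono) auto
    then show ?thesis by (simp add: algebra_simps)
  qed
  have "summable (\<lambda>n. \<alpha> n * ?I ?w n)"
  proof (rule summable_comparison_test)
    show "\<exists>N. \<forall>n\<ge>N. norm (\<alpha> n * ?I ?w n) \<le>
        2 * (cmod a)\<^sup>2 * (\<alpha> n * ?I u n) + 2 * (cmod b)\<^sup>2 * (\<alpha> n * ?I v n)"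
      using I \<alpha> by (auto simp: abs_mult less_imp_le)
    show "summable (\<lambda>n. 2 * (cmod a)\<^sup>2 * (\<alpha> n * ?I u n) + 2 * (cmod b)\<^sup>2 * (\<alpha> n * ?I v n))"
      by (intro summable_add summable_mult L2_netD(3) u v)
  qed
  with m i show ?thesis
    by (simp add: L2_net_def net_measurable_def)
qed

lemma L2_norm_power2:
  assumes "\<And>n. \<alpha> n > 0" and "u \<in> L2_net \<alpha>"
  shows "(L2_norm \<alpha> u)\<^sup>2 = (\<Sum>n. \<alpha> n * (\<integral>x. (cmod (u n x))\<^sup>2 \<partial>edge_measure n))"
  unfolding L2_norm_def
  by (rule real_sqrt_pow2) (use assms in \<open>auto intro!: suminf_nonneg L2_netD(3) mult_nonneg_nonneg less_imp_le[OF assms(1)]\<close>)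

lemma L2_norm_nonneg:
  assumes "\<And>n. \<alpha> n > 0" and "u \<in> L2_net \<alpha>"
  shows "L2_norm \<alpha> u \<ge> 0"
  unfolding L2_norm_def
  by (rule real_sqrt_ge_zero) (use assms in \<open>auto intro!: suminf_nonneg L2_netD(3) mult_nonneg_nonneg less_imp_le[OF assms(1)]\<close>)

text \<open>Unitarity is stated for \<open>L2_inner\<close>; this identity carries it over to
  \<open>L2_norm\<close>.\<close>

lemma L2_inner_self:
  assumes "\<And>n. \<alpha> n > 0" and "u \<in> L2_net \<alpha>"
  shows "L2_inner \<alpha> u u = complex_of_real ((L2_norm \<alpha> u)\<^sup>2)"
proof -
  have "L2_inner \<alpha> u u =
      (\<Sum>n. complex_of_real (\<alpha> n * (\<integral>x. (cmod (u n x))\<^sup>2 \<partial>edge_measure n)))"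
    unfolding L2_inner_def by (simp flip: complex_norm_square of_real_power)
  also have "\<dots> = complex_of_real (\<Sum>n. \<alpha> n * (\<integral>x. (cmod (u n x))\<^sup>2 \<partial>edge_measure n))"
    by (rule suminf_of_real[symmetric]) (rule L2_netD(3)[OF assms(2)])
  finally show ?thesis by (simp add: L2_norm_power2 assms)
qed

text \<open>The mean over one edge is a continuous functional on the weighted space: Cauchy-Schwarz
  bounds it on that edge, and a single term of the non-negative series is at most its sum.\<close>

lemma norm_edge_integral_le_L2_norm:
  assumes \<alpha>: "\<And>n. \<alpha> n > 0" and u: "u \<in> L2_net \<alpha>"
  shows "cmod (\<integral>x. u n x \<partial>edge_measure n) \<le> L2_norm \<alpha> u / sqrt (\<alpha> n)"
proof -
  let ?J = "\<integral>x. u n x \<partial>edge_measure n"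
  have "\<alpha> n * (cmod ?J)\<^sup>2 \<le> \<alpha> n * (\<integral>x. (cmod (u n x))\<^sup>2 \<partial>edge_measure n)"
    using \<alpha>[of n] norm_integral_edge_le[OF L2_netD(1,2)[OF u, of n]] by simp
  also have "\<dots> \<le> (\<Sum>n. \<alpha> n * (\<integral>x. (cmod (u n x))\<^sup>2 \<partial>edge_measure n))"
    using sum_le_suminf[OF L2_netD(3)[OF u], of "{n}"] \<alpha> by (simp add: less_imp_le)
  finally have "(sqrt (\<alpha> n) * cmod ?J)\<^sup>2 \<le> (L2_norm \<alpha> u)\<^sup>2"
    using \<alpha>[of n] by (simp add: L2_norm_power2[OF \<alpha> u] power_mult_distrib)
  then have "sqrt (\<alpha> n) * cmod ?J \<le> L2_norm \<alpha> u"
    by (rule power2_le_imp_le) (rule L2_norm_nonneg[OF \<alpha> u])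
  then show ?thesis
    using \<alpha>[of n] by (simp add: pos_le_divide_eq mult.commute)
qed

subsection \<open>Orbits of eigenvectors\<close>

lemma unitary_group_norm:
  assumes "\<And>n. \<alpha> n > 0" and "unitary_group \<alpha> U" and "u \<in> L2_net \<alpha>"
  shows "L2_norm \<alpha> (U t u) = L2_norm \<alpha> u"
proof -
  have Uu: "U t u \<in> L2_net \<alpha>" and "L2_inner \<alpha> (U t u) (U t u) = L2_inner \<alpha> u u"
    using assms by (auto simp: unitary_group_def)
  then have "(L2_norm \<alpha> (U t u))\<^sup>2 = (L2_norm \<alpha> u)\<^sup>2"
    using assms(1,3) by (simp add: L2_inner_self del: of_real_power)
  then show ?thesis
    by (rule power2_eq_imp_eq) (use assms Uu L2_norm_nonneg in auto)
qed

text \<open>The mean over the edge is a continuous linear functional, so strong differentiability of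
  the orbit passes to the scalar function \<open>g\<close>, which solves g' = c g. Only these scalar
  means are computed; the orbit itself is not identified.\<close>

lemma edge_integral_orbit:
  assumes \<alpha>: "\<And>n. \<alpha> n > 0" and U: "unitary_group \<alpha> U"
    and gen: "generator \<alpha> U u (\<lambda>n x. c * u n x)"
  shows "(\<integral>x. U t u n x \<partial>edge_measure n) = exp (c * of_real t) * (\<integral>x. u n x \<partial>edge_measure n)"
proof -
  define g where "g s = (\<integral>x. U s u n x \<partial>edge_measure n)" for s
  have u: "u \<in> L2_net \<alpha>"
    using gen by (simp add: generator_def)
  have UL: "U s v \<in> L2_net \<alpha>" if "v \<in> L2_net \<alpha>" for s v
    using U that by (simp add: unitary_group_def)
  have g': "(g has_vector_derivative c * g s) (at s)" for s
  proof -
    \<comment> \<open>The error of the difference quotient of the orbit at time 0; its norm tends to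
      0 by \<open>gen\<close>.\<close>
    define D where "D h n x = (U h u n x - u n x) / complex_of_real h - c * u n x" for h n x
    \<comment> \<open>Written as a linear combination, \<open>D h\<close> falls under closure of the
      space and linearity of \<open>U s\<close>. The identity also covers h = 0, where both
      divisions give 0.\<close>
    have D_eq: "D h = (\<lambda>n x. (1 / of_real h) * U h u n x + (- 1 / of_real h - c) * u n x)" for h
      by (auto simp: D_def fun_eq_iff field_simps diff_divide_distrib)
    have DL: "D h \<in> L2_net \<alpha>" for h
      unfolding D_eq by (intro L2_net_combination \<alpha> UL u)
    \<comment> \<open>Linearity and the group law turn \<open>U s\<close> applied to the error at
      time 0 into the error at time \<open>s\<close>, so differentiability at 0 gives it at every
      time.\<close>
    have quotient: "(\<integral>x. U s (D h) n x \<partial>edge_measure n) = (g (s + h) - g s) / of_real h - c * g s" for h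
    proof -
      have lin: "AE x in edge_measure n. U s (D h) n x =
          (1 / of_real h) * U s (U h u) n x + (- 1 / of_real h - c) * U s u n x"
        using U UL[OF u] u unfolding unitary_group_def net_eq_def D_eq by blast
      have comp: "AE x in edge_measure n. U (s + h) u n x = U s (U h u) n x"
        using U u unfolding unitary_group_def net_eq_def by blast
      have "(\<integral>x. U s (D h) n x \<partial>edge_measure n) =
          (\<integral>x. (1 / of_real h) * U (s + h) u n x + (- 1 / of_real h - c) * U s u n x \<partial>edge_measure n)"
      proof (rule integral_cong_AE)
        show "AE x in edge_measure n. U s (D h) n x =
            (1 / of_real h) * U (s + h) u n x + (- 1 / of_real h - c) * U s u n x"
          using lin comp by eventually_elim simp
        show "U s (D h) n \<in> borel_measurable (edge_measure n)"
          by (rule L2_netD(1)[OF UL[OF DL]])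
        show "(\<lambda>x. (1 / of_real h) * U (s + h) u n x + (- 1 / of_real h - c) * U s u n x)
            \<in> borel_measurable (edge_measure n)"
          by (rule L2_netD(1)[OF L2_net_combination[OF \<alpha> UL[OF u] UL[OF u]]])
      qed
      also have "\<dots> = (1 / of_real h) * g (s + h) + (- 1 / of_real h - c) * g s"
        unfolding g_def
        by (subst Bochner_Integration.integral_add) (auto intro!: integrable_mult_right L2_netD(4)[OF UL[OF u]])
      finally show ?thesis
        by (simp add: field_simps diff_divide_distrib)
    qed
    have "((\<lambda>h. L2_norm \<alpha> (D h)) \<longlongrightarrow> 0) (at 0)"
      using gen unfolding generator_def D_def by blast
    then have "((\<lambda>h. L2_norm \<alpha> (D h) / sqrt (\<alpha> n)) \<longlongrightarrow> 0) (at 0)"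
      by (rule tendsto_divide_zero)
    then have "((\<lambda>h. (g (s + h) - g s) / of_real h - c * g s) \<longlongrightarrow> 0) (at 0)"
    proof (rule Lim_null_comparison[rotated], intro always_eventually allI)
      fix h
      \<comment> \<open>\<open>U s\<close> preserves the norm, so the error at time \<open>s\<close>
        is controlled by that at time 0.\<close>
      show "norm ((g (s + h) - g s) / of_real h - c * g s) \<le> L2_norm \<alpha> (D h) / sqrt (\<alpha> n)"
        using norm_edge_integral_le_L2_norm[OF \<alpha> UL[OF DL], of n s h]
        by (simp add: quotient unitary_group_norm[OF \<alpha> U DL])
    qed
    then have "((\<lambda>h. (g (s + h) - g s) / of_real h) \<longlongrightarrow> c * g s) (at 0)"
      using Lim_null by blast
    then have "((\<lambda>h. norm ((g (s + h) - g s) / of_real h - c * g s)) \<longlongrightarrow> 0) (at 0)"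
      by (simp add: LIM_zero tendsto_norm_zero)
    \<comment> \<open>Passage to the form of the limit used by \<open>has_derivative_at\<close>; the
      identity is needed only for nonzero h, which the punctured ball supplies.\<close>
    moreover have "\<forall>\<^sub>F h in at 0. norm ((g (s + h) - g s) / of_real h - c * g s) =
        norm (g (s + h) - g s - h *\<^sub>R (c * g s)) / norm h"
    proof (rule eventually_mono[OF eventually_at_ball'[of 1 0 UNIV]])
      fix h :: real assume "h \<in> ball 0 1 \<and> h \<noteq> 0 \<and> h \<in> UNIV"
      then have "(g (s + h) - g s) / of_real h - c * g s = (g (s + h) - g s - h *\<^sub>R (c * g s)) / of_real h"
        by (simp add: scaleR_conv_of_real diff_divide_distrib)
      then show "norm ((g (s + h) - g s) / of_real h - c * g s) =
          norm (g (s + h) - g s - h *\<^sub>R (c * g s)) / norm h"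
        by (simp add: norm_divide)
    qed simp
    ultimately have "((\<lambda>h. norm (g (s + h) - g s - h *\<^sub>R (c * g s)) / norm h) \<longlongrightarrow> 0) (at 0)"
      using filterlim_cong by fastforce
    then show ?thesis
      by (simp add: has_vector_derivative_def has_derivative_at bounded_linear_scaleR_left)
  qed
  \<comment> \<open>Integrating factor: its product with \<open>g\<close> has derivative zero and is
    therefore constant.\<close>
  have "((\<lambda>s. exp (- c * of_real s) * g s) has_vector_derivative 0) (at s)" for s
  proof -
    have e: "((\<lambda>s. exp (- c * of_real s)) has_vector_derivative (- c * exp (- c * of_real s))) (at s)"
      by (rule has_vector_derivative_real_field) (auto intro!: derivative_eq_intros)
    show ?thesis
      using has_vector_derivative_mult[OF e g'[of s]] by (simp add: algebra_simps)
  qed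
  then obtain k where k: "\<And>s. exp (- c * of_real s) * g s = k"
    using has_vector_derivative_zero_constant[of UNIV "\<lambda>s. exp (- c * of_real s) * g s"]
    by auto
  have "g t = exp (c * of_real t) * k"
    using k[of t] by (simp add: exp_minus field_simps)
  also have "k = g 0"
    using k[of 0] by simp
  also have "g 0 = (\<integral>x. u n x \<partial>edge_measure n)"
    unfolding g_def
    by (rule integral_cong_AE)
       (use U u L2_netD(1)[OF u] L2_netD(1)[OF UL[OF u]] in \<open>auto simp: unitary_group_def net_eq_def\<close>)
  finally show ?thesis by (simp add: g_def)
qed

subsection \<open>The eigenfunction\<close>

text \<open>The square of f / \<alpha> n, weighted by \<alpha> n, is at most B^2 / \<alpha> n, which
  is summable. The lemma serves the eigenfunction and both of its derivatives.\<close>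

lemma scaled_L2_net:
  fixes f :: "real \<Rightarrow> real"
  assumes \<alpha>: "\<And>n. \<alpha> n > 0" and sum: "summable (\<lambda>n. 1 / \<alpha> n)"
    and f: "continuous_on UNIV f" and B: "\<And>x. \<bar>f x\<bar> \<le> B"
  shows "(\<lambda>n x. complex_of_real (f x / \<alpha> n)) \<in> L2_net \<alpha>"
proof -
  let ?I = "\<lambda>n. \<integral>x. (cmod (complex_of_real (f x / \<alpha> n)))\<^sup>2 \<partial>edge_measure n"
  have i: "integrable (edge_measure n) (\<lambda>x. (cmod (complex_of_real (f x / \<alpha> n)))\<^sup>2)" for n
    by (intro integrable_edge continuous_intros f) (use \<alpha>[of n] in auto)
  have "\<alpha> n * ?I n \<le> B\<^sup>2 * (1 / \<alpha> n)" for n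
  proof -
    interpret prob_space "edge_measure n" by (rule prob_space_edge)
    have "?I n \<le> (B / \<alpha> n)\<^sup>2"
    proof (rule integral_le_const[OF i], intro AE_I2)
      fix x
      show "(cmod (complex_of_real (f x / \<alpha> n)))\<^sup>2 \<le> (B / \<alpha> n)\<^sup>2"
        using B[of x] \<alpha>[of n] by (intro power_mono) (auto simp: norm_divide divide_right_mono)
    qed
    then have "\<alpha> n * ?I n \<le> \<alpha> n * (B / \<alpha> n)\<^sup>2"
      using \<alpha>[of n] by (intro mult_left_mono) auto
    also have "\<dots> = B\<^sup>2 * (1 / \<alpha> n)"
      using \<alpha>[of n] by (simp add: power2_eq_square)
    finally show ?thesis .
  qed
  moreover have "0 \<le> \<alpha> n * ?I n" for n
    using less_imp_le[OF \<alpha>[of n]] by simp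
  ultimately have "summable (\<lambda>n. \<alpha> n * ?I n)"
    by (intro summable_comparison_test'[OF summable_mult[OF sum, of "B\<^sup>2"]])
       (simp only: real_norm_def abs_of_nonneg)
  moreover have "(\<lambda>x. complex_of_real (f x / \<alpha> n)) \<in> borel_measurable (edge_measure n)" for n
    by (intro measurable_edge continuous_intros f) (use \<alpha>[of n] in auto)
  ultimately show ?thesis
    using i unfolding L2_net_def net_measurable_def by blast
qed

text \<open>Without the weight, the integral over the n-th edge is at most B / \<alpha> n, so the
  same series dominates.\<close>

lemma scaled_L1_net:
  fixes f :: "real \<Rightarrow> real"
  assumes \<alpha>: "\<And>n. \<alpha> n > 0" and sum: "summable (\<lambda>n. 1 / \<alpha> n)"
    and f: "continuous_on UNIV f" and B: "\<And>x. \<bar>f x\<bar> \<le> B"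
  shows "(\<lambda>n x. complex_of_real (f x / \<alpha> n)) \<in> L1_net"
proof -
  have "B \<ge> 0"
    using B[of 0] by linarith
  have "(\<integral>\<^sup>+x. ennreal (cmod (complex_of_real (f x / \<alpha> n))) \<partial>edge_measure n) \<le> ennreal (B * (1 / \<alpha> n))" for n
  proof -
    interpret prob_space "edge_measure n" by (rule prob_space_edge)
    have "(\<integral>\<^sup>+x. ennreal (cmod (complex_of_real (f x / \<alpha> n))) \<partial>edge_measure n)
        \<le> (\<integral>\<^sup>+x. ennreal (B * (1 / \<alpha> n)) \<partial>edge_measure n)"
      using B \<alpha>[of n] by (intro nn_integral_mono ennreal_leI) (auto simp: norm_divide divide_right_mono)
    also have "\<dots> = ennreal (B * (1 / \<alpha> n))"
      by (simp only: nn_integral_const emeasure_space_1 mult_1_right)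
    finally show ?thesis .
  qed
  then have "L1_norm (\<lambda>n x. complex_of_real (f x / \<alpha> n)) \<le> (\<Sum>n. ennreal (B * (1 / \<alpha> n)))"
    unfolding L1_norm_def by (intro suminf_le) auto
  also have "\<dots> = ennreal (\<Sum>n. B * (1 / \<alpha> n))"
    by (intro suminf_ennreal2 summable_mult sum) (use \<open>B \<ge> 0\<close> \<alpha> in \<open>auto simp: less_imp_le\<close>)
  also have "\<dots> < \<infinity>" by simp
  finally have "L1_norm (\<lambda>n x. complex_of_real (f x / \<alpha> n)) < \<infinity>" .
  moreover have "(\<lambda>x. complex_of_real (f x / \<alpha> n)) \<in> borel_measurable (edge_measure n)" for n
    by (intro measurable_edge continuous_intros f) (use \<alpha>[of n] in auto)
  ultimately show ?thesis
    by (simp add: L1_net_def net_measurable_def)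
qed

text \<open>The variable x is the coordinate on the whole half-line, not one restarted on each edge,
  so the derivatives of the sine match at the vertices with no alternating signs.\<close>

definition vertex_sine :: "(nat \<Rightarrow> real) \<Rightarrow> netfun" where
  "vertex_sine \<alpha> = (\<lambda>n x. complex_of_real (sin (pi * x) / \<alpha> n))"

lemma vertex_sine_L2_net:
  assumes "\<And>n. \<alpha> n > 0" and "summable (\<lambda>n. 1 / \<alpha> n)"
  shows "vertex_sine \<alpha> \<in> L2_net \<alpha>"
  unfolding vertex_sine_def
  by (rule scaled_L2_net[where B=1, OF assms]) (auto intro!: continuous_intros)

lemma vertex_sine_L1_net:
  assumes "\<And>n. \<alpha> n > 0" and "summable (\<lambda>n. 1 / \<alpha> n)"
  shows "vertex_sine \<alpha> \<in> L1_net"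
  unfolding vertex_sine_def
  by (rule scaled_L1_net[where B=1, OF assms]) (auto intro!: continuous_intros)

lemma laplacian_vertex_sine:
  assumes \<alpha>: "\<And>n. \<alpha> n > 0" and sum: "summable (\<lambda>n. 1 / \<alpha> n)"
  shows "laplacian \<alpha> (vertex_sine \<alpha>) (\<lambda>n x. complex_of_real (- pi\<^sup>2) * vertex_sine \<alpha> n x)"
proof -
  \<comment> \<open>The factor \<alpha> n cancels the denominator of \<open>u1\<close>, leaving pi
    cos (pi x) on every edge; this is the flux condition at the vertices.\<close>
  define u1 :: netfun where "u1 = (\<lambda>n x. complex_of_real (pi * cos (pi * x) / \<alpha> n))"
  \<comment> \<open>Written as one quotient by \<alpha> n so that \<open>scaled_L2_net\<close>
    applies, with bound pi^2.\<close>
  define w :: netfun where "w = (\<lambda>n x. complex_of_real (- pi\<^sup>2 * sin (pi * x) / \<alpha> n))"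
  have w: "w = (\<lambda>n x. complex_of_real (- pi\<^sup>2) * vertex_sine \<alpha> n x)"
    by (simp add: w_def vertex_sine_def)
  have \<alpha>0: "\<alpha> n \<noteq> 0" for n
    using \<alpha>[of n] by simp
  have c0: "continuous_on S (vertex_sine \<alpha> n)" and c1: "continuous_on S (u1 n)"
    and c2: "continuous_on S (w n)" for n S
    unfolding vertex_sine_def u1_def w_def by (auto intro!: continuous_intros simp: \<alpha>0)
  have "H2_net \<alpha> (vertex_sine \<alpha>) u1 w"
    unfolding H2_net_def
  proof (intro conjI allI)
    show "vertex_sine \<alpha> \<in> L2_net \<alpha>"
      by (rule vertex_sine_L2_net[OF \<alpha> sum])
    show "u1 \<in> L2_net \<alpha>"
      unfolding u1_def
      by (rule scaled_L2_net[where B=pi, OF \<alpha> sum]) (auto intro!: continuous_intros simp: abs_mult)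
    show "w \<in> L2_net \<alpha>"
      unfolding w_def
      by (rule scaled_L2_net[where B="pi\<^sup>2", OF \<alpha> sum]) (auto intro!: continuous_intros simp: abs_mult)
    show "weak_deriv n (vertex_sine \<alpha> n) (u1 n)" for n
      using \<alpha>0[of n] by (intro weak_deriv_of_vector_derivative[OF _ c1])
         (auto simp: vertex_sine_def u1_def simp del: of_real_divide of_real_mult
           intro!: has_vector_derivative_of_real derivative_eq_intros
           simp flip: has_real_derivative_iff_has_vector_derivative)
    show "weak_deriv n (u1 n) (w n)" for n
      using \<alpha>0[of n] by (intro weak_deriv_of_vector_derivative[OF _ c2])
         (auto simp: w_def u1_def power2_eq_square simp del: of_real_divide of_real_mult
           intro!: has_vector_derivative_of_real derivative_eq_intros
           simp flip: has_real_derivative_iff_has_vector_derivative)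
  qed
  \<comment> \<open>All vertices are zeros of the sine, so continuity holds although the amplitudes
    1 / \<alpha> n change from edge to edge.\<close>
  moreover have "sin (pi * (real n + 1)) = 0" for n
    by (metis add.commute mult.commute of_nat_Suc sin_npi)
  moreover have "edge_trace n (vertex_sine \<alpha> n) x = vertex_sine \<alpha> n x"
    "edge_trace n (u1 n) x = u1 n x" if "x \<in> {real n..real n + 1}" for n x
    using that by (simp_all only: edge_trace_eq c0 c1)
  ultimately have "H2_net \<alpha> (vertex_sine \<alpha>) u1 w"
    "edge_trace 0 (vertex_sine \<alpha> 0) 0 = 0"
    "edge_trace n (vertex_sine \<alpha> n) (real n + 1) = edge_trace (Suc n) (vertex_sine \<alpha> (Suc n)) (real n + 1)"
    "complex_of_real (\<alpha> n) * edge_trace n (u1 n) (real n + 1) =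
      complex_of_real (\<alpha> (Suc n)) * edge_trace (Suc n) (u1 (Suc n)) (real n + 1)" for n
    by (simp_all add: vertex_sine_def[of \<alpha>, THEN fun_cong, THEN fun_cong]
        u1_def[THEN fun_cong, THEN fun_cong] \<alpha>0)
  then show ?thesis
    unfolding laplacian_def w[symmetric] by blast
qed

text \<open>Exactly half a period of the sine fits on the first edge, so the mean there is nonzero,
  and it can bound the orbit from below.\<close>

lemma integral_vertex_sine:
  assumes "\<alpha> 0 > 0"
  shows "(\<integral>x. vertex_sine \<alpha> 0 x \<partial>edge_measure 0) = complex_of_real (2 / (pi * \<alpha> 0))"
proof -
  have "((\<lambda>x. complex_of_real (- cos (pi * x) / (pi * \<alpha> 0))) has_vector_derivative vertex_sine \<alpha> 0 x) (at x)" for x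
    unfolding vertex_sine_def
    by (rule has_vector_derivative_of_real)
       (use assms in \<open>auto intro!: derivative_eq_intros
         simp flip: has_real_derivative_iff_has_vector_derivative\<close>)
  moreover have "continuous_on UNIV (vertex_sine \<alpha> 0)"
    unfolding vertex_sine_def using assms by (intro continuous_intros) auto
  ultimately show ?thesis
    by (subst integral_edge_FTC) (auto simp: field_simps)
qed

section \<open>A positive lower bound for the operator norm, uniform in time\<close>

theorem theorem2p2:
  fixes \<alpha> :: "nat \<Rightarrow> real" and U :: "real \<Rightarrow> netfun \<Rightarrow> netfun"
  assumes "\<And>n. \<alpha> n > 0"
    and "summable (\<lambda>n. 1 / \<alpha> n)"
    and "schroedinger_group \<alpha> U"
  shows "\<not> ((\<lambda>t. L1_Linf_norm \<alpha> (U t)) \<longlongrightarrow> 0) at_infinity"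
proof
  define \<phi> where "\<phi> = vertex_sine \<alpha>"
  define m where "m = 2 / (pi * \<alpha> 0)"
  have "m > 0"
    using assms(1)[of 0] by (simp add: m_def)
  have U: "unitary_group \<alpha> U"
    using assms(3) by (simp add: schroedinger_group_def)
  have L2: "\<phi> \<in> L2_net \<alpha>" and L1: "\<phi> \<in> L1_net"
    using assms vertex_sine_L2_net vertex_sine_L1_net by (auto simp: \<phi>_def)
  have mean: "(\<integral>x. \<phi> 0 x \<partial>edge_measure 0) = complex_of_real m"
    using assms(1) by (simp add: \<phi>_def m_def integral_vertex_sine del: of_real_divide of_real_mult)
  \<comment> \<open>The supremum in \<open>L1_Linf_norm\<close> admits only nonzero classes; a null
    function would have mean 0 instead of \<open>m\<close>.\<close>
  have nonzero: "\<not> net_eq \<phi> (\<lambda>n x. 0)"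
  proof
    assume "net_eq \<phi> (\<lambda>n x. 0)"
    then have "(\<integral>x. \<phi> 0 x \<partial>edge_measure 0) = (\<integral>x. 0 \<partial>edge_measure 0)"
      by (intro integral_cong_AE) (use L2 L2_netD(1) in \<open>auto simp: net_eq_def\<close>)
    with mean \<open>m > 0\<close> show False by simp
  qed
  have "generator \<alpha> U \<phi> (\<lambda>n x. \<i> * (complex_of_real (- pi\<^sup>2) * \<phi> n x))"
    unfolding \<phi>_def
    by (rule assms(3)[unfolded schroedinger_group_def, THEN conjunct2, rule_format, THEN iffD2])
       (rule laplacian_vertex_sine[OF assms(1,2)])
  then have gen: "generator \<alpha> U \<phi> (\<lambda>n x. (\<i> * complex_of_real (- pi\<^sup>2)) * \<phi> n x)"
    by (simp only: mult.assoc)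
  \<comment> \<open>Testing the supremum with the single function \<phi> gives a bound independent
    of t.\<close>
  have lower: "ennreal m / L1_norm \<phi> \<le> L1_Linf_norm \<alpha> (U t)" for t
  proof -
    have "U t \<phi> \<in> L2_net \<alpha>"
      using U L2 by (simp add: unitary_group_def)
    then have "ennreal (cmod (\<integral>x. U t \<phi> 0 x \<partial>edge_measure 0)) \<le>
        esssup (edge_measure 0) (\<lambda>x. ennreal (cmod (U t \<phi> 0 x)))"
      by (intro norm_integral_edge_le_esssup L2_netD(4))
    also have "\<dots> \<le> Linf_norm (U t \<phi>)"
      unfolding Linf_norm_def by (rule SUP_upper) simp
    \<comment> \<open>The exponent -i pi^2 t is purely imaginary, so the exponential factor has
      modulus 1.\<close>
    also have "cmod (\<integral>x. U t \<phi> 0 x \<partial>edge_measure 0) = m"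
      unfolding edge_integral_orbit[OF assms(1) U gen] mean
      using \<open>m > 0\<close> by (simp add: norm_mult)
    finally have "ennreal m / L1_norm \<phi> \<le> Linf_norm (U t \<phi>) / L1_norm \<phi>"
      by (rule divide_right_mono_ennreal)
    also have "\<dots> \<le> L1_Linf_norm \<alpha> (U t)"
      unfolding L1_Linf_norm_def by (rule SUP_upper) (use L1 L2 nonzero in auto)
    finally show ?thesis .
  qed
  \<comment> \<open>Finiteness of the L^1 norm matters here, since division by infinity would give
    0.\<close>
  have "0 < ennreal m / L1_norm \<phi>"
    using \<open>m > 0\<close> L1 by (simp add: ennreal_zero_less_divide L1_net_def)
  moreover assume "((\<lambda>t. L1_Linf_norm \<alpha> (U t)) \<longlongrightarrow> 0) at_infinity"
  ultimately have "eventually (\<lambda>t. L1_Linf_norm \<alpha> (U t) < ennreal m / L1_norm \<phi>) at_infinity"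
    by (rule order_tendstoD(2)[rotated])
  \<comment> \<open>Convergence to 0 would push the norm below its own lower bound for all large
    |t|, yet the filter at infinity on the reals is nontrivial.\<close>
  then have "eventually (\<lambda>t :: real. False) at_infinity"
    by (rule eventually_mono) (use lower leD in blast)
  then show False
    by (simp add: trivial_limit_at_infinity)
qed

end
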